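(* Let $F$ be a field, $A$ a finite-dimensional associative $F$-algebra with two-sided identity $1_A \neq 0_A$, and $H$ an $F$-subspace of $A$ of codimension one. Suppose it is not the case that both $|F| = 2$ and $A$ has a factor algebra (quotient by a two-sided ideal) isomorphic to $\mathbb{F}_2 \oplus \mathbb{F}_2$. Then $H \setminus U(A) \neq \emptyset$, i.e. $U(A) \not\subseteq H$.
   Context: $U(A)$ denotes the group of units of $A$, i.e. the set of elements having a two-sided multiplicative inverse. $\mathbb{F}_2$ is the field with two elements. *)

theory Defs
  imports
    "Jordan_Normal_Form.Missing_VectorSpace"
    "HOL-Algebra.QuotRing"
    "HOL-Algebra.Chinese_Remainder"
begin

(* The library locale "algebra" demands a commutative multiplication, hence this variant. *)
locale unital_algebra = vectorspace F A + ring A for F and A (structure) +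
  assumes smult_mult_left:
      "\<lbrakk>c \<in> carrier F; x \<in> carrier A; y \<in> carrier A\<rbrakk> \<Longrightarrow> (c \<odot> x) \<otimes> y = c \<odot> (x \<otimes> y)"
    and smult_mult_right:
      "\<lbrakk>c \<in> carrier F; x \<in> carrier A; y \<in> carrier A\<rbrakk> \<Longrightarrow> x \<otimes> (c \<odot> y) = c \<odot> (x \<otimes> y)"

(* The scalar action on cosets has the same shape as rcoset_mult in FactRing; when I is a
   two-sided ideal, c acts on the coset of x by giving the coset of c \<odot> x (smult_coset below). *)
definition factor_algebra ::
    "('a, 'b, 'm) module_scheme \<Rightarrow> 'b set \<Rightarrow> ('a, 'b set) module"
  where "factor_algebra A I = ring.extend (A Quot I)
           \<lparr> smult = (\<lambda>c X. \<Union>x\<in>X. I +>\<^bsub>A\<^esub> (c \<odot>\<^bsub>A\<^esub> x)) \<rparr>"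

definition square_algebra :: "('a, 'n) ring_scheme \<Rightarrow> ('a, 'a \<times> 'a) module"
  where "square_algebra F = ring.extend (RDirProd F F)
           \<lparr> smult = (\<lambda>c (x, y). (c \<otimes>\<^bsub>F\<^esub> x, c \<otimes>\<^bsub>F\<^esub> y)) \<rparr>"

definition algebra_isomorphic ::
    "('a, 'n) ring_scheme \<Rightarrow> ('a, 'b, 'm) module_scheme \<Rightarrow> ('a, 'c, 'k) module_scheme \<Rightarrow> bool"
  where "algebra_isomorphic F A B \<longleftrightarrow>
           (\<exists>h. h \<in> ring_iso A B \<and> h \<in> LinearCombinations.module_hom F A B)"

(* A field F with two elements is the field of two elements, so over such an F the algebra
   square_algebra F is the direct sum of two copies of the field of two elements. *)
definition has_F2_square_factor ::
    "('a, 'n) ring_scheme \<Rightarrow> ('a, 'b, 'm) module_scheme \<Rightarrow> bool"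
  where "has_F2_square_factor F A \<longleftrightarrow>
           card (carrier F) = 2 \<and>
           (\<exists>I. ideal I A \<and> algebra_isomorphic F (factor_algebra A I) (square_algebra F))"

lemma factor_algebra_simps:
  "carrier (factor_algebra A I) = carrier (A Quot I)"
  "mult (factor_algebra A I) = mult (A Quot I)"
  "one (factor_algebra A I) = one (A Quot I)"
  "zero (factor_algebra A I) = zero (A Quot I)"
  "add (factor_algebra A I) = add (A Quot I)"
  "smult (factor_algebra A I) = (\<lambda>c X. \<Union>x\<in>X. I +>\<^bsub>A\<^esub> (c \<odot>\<^bsub>A\<^esub> x))"
  by (simp_all add: factor_algebra_def ring.defs)

lemma square_algebra_simps:
  "carrier (square_algebra F) = carrier F \<times> carrier F"
  "(x, y) \<otimes>\<^bsub>square_algebra F\<^esub> (x', y') = (x \<otimes>\<^bsub>F\<^esub> x', y \<otimes>\<^bsub>F\<^esub> y')"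
  "\<one>\<^bsub>square_algebra F\<^esub> = (\<one>\<^bsub>F\<^esub>, \<one>\<^bsub>F\<^esub>)"
  "\<zero>\<^bsub>square_algebra F\<^esub> = (\<zero>\<^bsub>F\<^esub>, \<zero>\<^bsub>F\<^esub>)"
  "(x, y) \<oplus>\<^bsub>square_algebra F\<^esub> (x', y') = (x \<oplus>\<^bsub>F\<^esub> x', y \<oplus>\<^bsub>F\<^esub> y')"
  "c \<odot>\<^bsub>square_algebra F\<^esub> (x, y) = (c \<otimes>\<^bsub>F\<^esub> x, c \<otimes>\<^bsub>F\<^esub> y)"
  by (simp_all add: square_algebra_def RDirProd_def DirProd_def ring.defs monoid.defs)

lemma (in unital_algebra) ideal_smult_closed:
  assumes "ideal I A" and "c \<in> carrier F" and "x \<in> I"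
  shows "c \<odot> x \<in> I"
proof -
  interpret I: ideal I A by fact
  have x: "x \<in> carrier A" using assms(3) by (rule I.a_Hcarr)
  have one: "\<one> \<in> carrier A" by (rule monoid.one_closed[OF ring.is_monoid[OF ideal.axioms(2)[OF assms(1)]]])
  have "c \<odot> x = (c \<odot> \<one>) \<otimes> x"
    using smult_mult_left[OF assms(2) one x] x
      monoid.l_one[OF ring.is_monoid[OF ideal.axioms(2)[OF assms(1)]]] by simp
  moreover have "c \<odot> \<one> \<in> carrier A" using assms(2) one by (rule smult_closed)
  ultimately show ?thesis using I.I_l_closed[OF assms(3)] by simp
qed

lemma (in unital_algebra) smult_coset:
  assumes "ideal I A" and c: "c \<in> carrier F" and x: "x \<in> carrier A"
  shows "c \<odot>\<^bsub>factor_algebra A I\<^esub> (I +> x) = I +> (c \<odot> x)"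
proof -
  interpret I: ideal I A by fact
  have *: "I +> (c \<odot> y) = I +> (c \<odot> x)" if y: "y \<in> I +> x" for y
  proof -
    obtain i where i: "i \<in> I" and y_eq: "y = i \<oplus> x"
      using y by (auto simp: a_r_coset_def')
    have "c \<odot> y = c \<odot> i \<oplus> c \<odot> x"
      unfolding y_eq using c I.a_Hcarr[OF i] x by (rule smult_r_distr)
    then have "c \<odot> y \<in> I +> (c \<odot> x)"
      using ideal_smult_closed[OF assms(1) c i] by (auto simp: a_r_coset_def')
    then show ?thesis
      using I.a_repr_independence' smult_closed[OF c x] by simp
  qed
  have "x \<in> I +> x" using x by (rule I.a_rcos_self)
  then have "(\<Union>y\<in>I +> x. I +> (c \<odot> y)) = (\<Union>y\<in>I +> x. I +> (c \<odot> x))"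
    using * by (intro SUP_cong refl) blast
  also have "\<dots> = I +> (c \<odot> x)" using \<open>x \<in> I +> x\<close> by blast
  finally show ?thesis unfolding factor_algebra_simps .
qed

end

theory Submission
  imports "HOL-Algebra.Subrings" Defs
begin

text \<open>
  Let \<open>S\<close> be the span of the units, which is a subalgebra. By Fitting's lemma every element of
  \<open>A\<close> is congruent modulo \<open>S\<close> to an idempotent, so if \<open>S\<close> is proper it misses an idempotent. If
  \<open>F\<close> contains some \<open>c\<close> other than \<open>0\<close> and \<open>1\<close>, this is impossible, since \<open>1 - e + c e\<close> is a unit
  for every idempotent \<open>e\<close>. If \<open>|F| = 2\<close>, take an idempotent \<open>f\<close> outside \<open>S\<close> that is minimal.
  Minimality makes every element of \<open>f A f\<close> congruent to \<open>0\<close> or \<open>f\<close> modulo \<open>S\<close>, and \<open>f A (1 - f)\<close>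
  and \<open>(1 - f) A f\<close> lie in \<open>S\<close> because their elements have square zero; hence \<open>x \<mapsto> f x f\<close> modulo
  \<open>S\<close> is a ring homomorphism onto \<open>F\<close>. As \<open>1 - f\<close> is not in \<open>S\<close> either, there is a second minimal
  idempotent \<open>h\<close> below \<open>1 - f\<close>, and the two homomorphisms together map \<open>A\<close> onto \<open>F \<oplus> F\<close>.
\<close>

section \<open>Nilpotent elements and Fitting's lemma in a ring\<close>

lemma (in ring) add_cancel_middle:
  assumes "x \<in> carrier R" "y \<in> carrier R"
  shows "x \<oplus> (y \<oplus> \<ominus> x) = y" "\<ominus> x \<oplus> (y \<oplus> x) = y"
  using assms a_lcomm[of x y "\<ominus> x"] a_lcomm[of "\<ominus> x" y x] by (simp_all add: r_neg l_neg)

text \<open>The inverse is the geometric sum 1 + x + ... + x^(n-1). The induction builds it as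
  \<open>y\<close> with 1 - x^n as the value of both products, so nilpotency enters only at the
  end.\<close>

lemma (in ring) one_minus_nilpotent_Units:
  assumes x: "x \<in> carrier R" and nil: "x [^] (n::nat) = \<zero>"
  shows "\<one> \<ominus> x \<in> Units R"
proof -
  have "\<exists>y\<in>carrier R. (\<one> \<ominus> x) \<otimes> y = \<one> \<ominus> x [^] n \<and> y \<otimes> (\<one> \<ominus> x) = \<one> \<ominus> x [^] n"
  proof (induction n)
    case 0
    show ?case using x by (intro bexI[of _ \<zero>]) (simp_all add: minus_eq r_neg)
  next
    case (Suc n)
    then obtain y where y: "y \<in> carrier R"
      "(\<one> \<ominus> x) \<otimes> y = \<one> \<ominus> x [^] n" "y \<otimes> (\<one> \<ominus> x) = \<one> \<ominus> x [^] n"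
      by blast
    have p: "x [^] n \<in> carrier R" using x by simp
    have c: "x \<otimes> x [^] n = x [^] Suc n" "x [^] n \<otimes> x = x [^] Suc n"
      using x by (simp_all add: nat_pow_Suc2[OF x, symmetric])
    have q: "x [^] Suc n \<in> carrier R" using x by blast
    have "(\<one> \<ominus> x) \<otimes> (y \<oplus> x [^] n) = (\<one> \<ominus> x) \<otimes> y \<oplus> (x [^] n \<ominus> x \<otimes> x [^] n)"
      using x y(1) p by (simp add: ring_simprules)
    also have "\<dots> = \<one> \<ominus> x [^] Suc n" unfolding y c using p q by (simp add: ring_simprules)
    finally have 1: "(\<one> \<ominus> x) \<otimes> (y \<oplus> x [^] n) = \<one> \<ominus> x [^] Suc n" .
    have "(y \<oplus> x [^] n) \<otimes> (\<one> \<ominus> x) = y \<otimes> (\<one> \<ominus> x) \<oplus> (x [^] n \<ominus> x [^] n \<otimes> x)"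
      using x y(1) p by (simp add: ring_simprules)
    also have "\<dots> = \<one> \<ominus> x [^] Suc n" unfolding y c using p q by (simp add: ring_simprules)
    finally show ?case using 1 y(1) p by blast
  qed
  then show ?thesis using nil by (auto simp: Units_def minus_eq x)
qed

lemma (in ring) square_zero_Units:
  assumes "x \<in> carrier R" "x \<otimes> x = \<zero>"
  shows "\<one> \<ominus> x \<in> Units R"
  using one_minus_nilpotent_Units[of x 2] assms by (simp add: numeral_2_eq_2)

text \<open>Fitting's decomposition for a single element: \<open>a\<close> is invertible on the part
  cut out by \<open>e\<close> and nilpotent on the part cut out by 1 - e. The invertible part gives
  the unit u = a e + (1 - e), the nilpotent part the unit v = 1 - a (1 - e).\<close>

lemma (in ring) fitting_idempotent:
  fixes k :: nat
  assumes a: "a \<in> carrier R" and b: "b \<in> carrier R" and ab: "a \<otimes> b = b \<otimes> a"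
    and stable: "a [^] k = a [^] Suc k \<otimes> b"
  obtains e c u v where "e \<in> carrier R" "e \<otimes> e = e" "c \<in> carrier R" "e = a \<otimes> c" "e = c \<otimes> a"
    "u \<in> Units R" "v \<in> Units R" "a \<ominus> e = u \<ominus> v"
proof -
  \<comment> \<open>The exponent is k + 1 so that \<open>e\<close> has a factor t = a b to spare,
    which yields e = a c with c = b t^k.\<close>
  define m where "m = Suc k"
  define t where "t = a \<otimes> b"
  define e where "e = t [^] m"
  define c where "c = b \<otimes> t [^] k"
  have t: "t \<in> carrier R" and e: "e \<in> carrier R" and c: "c \<in> carrier R"
    using a b by (simp_all add: t_def e_def c_def)
  have at: "a \<otimes> t = t \<otimes> a"
    using a b by (simp add: t_def m_assoc ab[symmetric])
  have bt: "b \<otimes> t = t \<otimes> b"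
    using a b by (simp add: t_def m_assoc ab)
  have comm_pow: "y \<otimes> t [^] n = t [^] n \<otimes> y" if "y \<in> carrier R" "y \<otimes> t = t \<otimes> y" for y and n :: nat
    using group_commutes_pow[of t y n] that t by simp
  have pow_t: "a [^] m \<otimes> t = a [^] m"
  proof -
    have "a [^] m \<otimes> t = a \<otimes> (a [^] Suc k \<otimes> b)"
      unfolding m_def t_def using a b group_commutes_pow[of a a "Suc k"]
      by (simp add: m_assoc[symmetric] del: nat_pow_Suc)
    also have "\<dots> = a [^] m" unfolding stable[symmetric] m_def using a by (simp only: nat_pow_Suc2)
    finally show ?thesis .
  qed
  have pow_tn: "a [^] m \<otimes> t [^] n = a [^] m" for n :: nat
  proof (induction n)
    case (Suc n)
    have "a [^] m \<otimes> t [^] Suc n = (a [^] m \<otimes> t [^] n) \<otimes> t" using a t by (simp add: m_assoc)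
    then show ?case using Suc pow_t by simp
  qed (use a in simp)
  \<comment> \<open>In this form \<open>e\<close> inherits from a^m that multiplication by powers of
    \<open>t\<close> on the right does not change it; as \<open>e\<close> is itself such a power, it
    is idempotent.\<close>
  have e_eq: "e = b [^] m \<otimes> a [^] m"
    unfolding e_def t_def using a b ab pow_mult_distrib[of b a m] by simp
  have ee: "e \<otimes> e = e"
  proof -
    have "e \<otimes> e = b [^] m \<otimes> (a [^] m \<otimes> e)" using a b e by (simp add: e_eq m_assoc)
    then show ?thesis using pow_tn[of m] by (simp add: e_def[symmetric] e_eq[symmetric])
  qed
  have et: "e \<otimes> t = e"
    using pow_t a b t by (simp add: m_assoc e_eq)
  have te: "t \<otimes> e = e"
    using et comm_pow[of t m] t unfolding e_def by simp
  have ae: "a \<otimes> e = e \<otimes> a" and be: "b \<otimes> e = e \<otimes> b"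
    unfolding e_def using comm_pow a b at bt by auto
  have e_ac: "e = a \<otimes> c"
    unfolding e_def m_def c_def using a b t nat_pow_Suc2[OF t, of k] by (simp add: t_def m_assoc)
  have e_ca: "e = c \<otimes> a"
  proof -
    have "c \<otimes> a = b \<otimes> (a \<otimes> t [^] k)"
      unfolding c_def using a b t comm_pow[OF a at] by (simp add: m_assoc)
    also have "\<dots> = e"
      unfolding e_def m_def using a b t nat_pow_Suc2[OF t, of k] ab by (simp add: t_def m_assoc[symmetric])
    finally show ?thesis by simp
  qed
  \<comment> \<open>On the \<open>e\<close>-part \<open>u\<close> acts as \<open>a\<close> and
    \<open>w\<close> as \<open>b\<close>, where a b = t acts as the identity; on the complement both
    are the identity. Thus \<open>w\<close> is the inverse of \<open>u\<close>, while
    \<open>n\<close> is the nilpotent part of \<open>a\<close>.\<close>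
  define u where "u = a \<otimes> e \<oplus> (\<one> \<ominus> e)"
  define w where "w = b \<otimes> e \<oplus> (\<one> \<ominus> e)"
  define n where "n = a \<otimes> (\<one> \<ominus> e)"
  \<comment> \<open>Stated for general \<open>x\<close> and \<open>y\<close> so that exchanging
    \<open>a\<close> and \<open>b\<close> gives both u w = 1 and w u = 1.\<close>
  have aux: "(x \<otimes> e \<oplus> (\<one> \<ominus> e)) \<otimes> (y \<otimes> e \<oplus> (\<one> \<ominus> e)) = \<one>"
    if x: "x \<in> carrier R" and y: "y \<in> carrier R" and xy: "x \<otimes> y = t"
      and ye: "y \<otimes> e = e \<otimes> y" for x y
  proof -
    have 1: "x \<otimes> e \<otimes> (y \<otimes> e) = e"
    proof -
      have "x \<otimes> e \<otimes> (y \<otimes> e) = x \<otimes> (e \<otimes> y) \<otimes> e" using x y e by (simp add: m_assoc)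
      also have "\<dots> = x \<otimes> y \<otimes> (e \<otimes> e)" unfolding ye[symmetric] using x y e by (simp add: m_assoc)
      finally show ?thesis by (simp add: xy ee te)
    qed
    have 2: "e \<otimes> (y \<otimes> e) = y \<otimes> e"
      using y e ee by (simp add: ye[symmetric] flip: m_assoc) (simp add: m_assoc)
    have "(x \<otimes> e \<oplus> (\<one> \<ominus> e)) \<otimes> (y \<otimes> e \<oplus> (\<one> \<ominus> e)) =
       x \<otimes> e \<otimes> (y \<otimes> e) \<oplus> (x \<otimes> e \<ominus> x \<otimes> (e \<otimes> e)) \<oplus> (y \<otimes> e \<ominus> e \<otimes> (y \<otimes> e)) \<oplus> (\<one> \<ominus> e \<ominus> e \<oplus> e \<otimes> e)"
      using x y e by (simp add: ring_simprules)
    also have "\<dots> = e \<oplus> (\<one> \<ominus> e)" unfolding 1 2 ee using x y e by (simp add: minus_eq r_neg l_neg a_assoc)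
    also have "\<dots> = \<one>" using e by (simp add: minus_eq add_cancel_middle)
    finally show ?thesis .
  qed
  have "u \<otimes> w = \<one>" "w \<otimes> u = \<one>"
    unfolding u_def w_def using aux[OF a b _ be] aux[OF b a _ ae] ab t_def by metis+
  moreover have uw: "u \<in> carrier R" "w \<in> carrier R"
    unfolding u_def w_def using a b e by simp_all
  ultimately have u: "u \<in> Units R" unfolding Units_def by blast
  have n: "n \<in> carrier R" unfolding n_def using a e by simp
  have f: "\<one> \<ominus> e \<in> carrier R" using e by simp
  \<comment> \<open>The factors of \<open>n\<close> commute, so n^m = a^m (1 - e)^m, and a single
    factor 1 - e already kills a^m because a^m e = a^m.\<close>
  have "a \<otimes> (\<one> \<ominus> e) = (\<one> \<ominus> e) \<otimes> a" using a e ae by (simp add: ring_simprules)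
  then have "n [^] m = a [^] m \<otimes> (\<one> \<ominus> e) [^] m"
    unfolding n_def using pow_mult_distrib a f by simp
  also have "\<dots> = (a [^] m \<otimes> (\<one> \<ominus> e)) \<otimes> (\<one> \<ominus> e) [^] k"
    unfolding m_def using a f nat_pow_Suc2[OF f, of k] by (simp add: m_assoc)
  also have "a [^] m \<otimes> (\<one> \<ominus> e) = \<zero>"
  proof -
    have p: "a [^] m \<in> carrier R" using a by simp
    have "a [^] m \<otimes> (\<one> \<ominus> e) = a [^] m \<ominus> a [^] m \<otimes> e" using p e by (simp add: ring_simprules)
    also have "\<dots> = \<zero>" using pow_tn[of m] p by (simp add: e_def minus_eq r_neg)
    finally show ?thesis .
  qed
  finally have "n [^] m = \<zero>" using f by simp
  then have v: "\<one> \<ominus> n \<in> Units R" using one_minus_nilpotent_Units n by blast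
  have "a \<ominus> e = u \<ominus> (\<one> \<ominus> n)"
    unfolding u_def n_def using a e by (simp add: ring_simprules add_cancel_middle)
  then show thesis using that e ee c e_ac e_ca u v by blast
qed

section \<open>Corners and minimal idempotents modulo a subring containing the units\<close>

text \<open>Collects what the idempotent argument uses about the span of the units, without scalars.
  The idempotent is required to lie in both a R and R a so that, for \<open>a\<close> in a corner f
  R f, it lies in that corner too.\<close>

locale units_subring = ring R for R (structure) +
  fixes S
  assumes subring: "subring S R"
    and Units_subset: "Units R \<subseteq> S"
    and idempotent_mod: "a \<in> carrier R \<Longrightarrow>
      \<exists>e\<in>carrier R. e \<otimes> e = e \<and> (\<exists>c\<in>carrier R. e = a \<otimes> c) \<and> (\<exists>c\<in>carrier R. e = c \<otimes> a) \<and> a \<ominus> e \<in> S"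
begin

lemma S_carrier: "x \<in> S \<Longrightarrow> x \<in> carrier R"
  using subringE(1)[OF subring] by blast

lemmas S_zero = subringE(2)[OF subring]
  and S_one = subringE(3)[OF subring]
  and S_mult = subringE(6)[OF subring]
  and S_add = subringE(7)[OF subring]

lemma S_minus: "x \<in> S \<Longrightarrow> y \<in> S \<Longrightarrow> x \<ominus> y \<in> S"
  unfolding minus_eq by (intro S_add subringE(5)[OF subring])

lemma minus_S_cancel:
  assumes "x \<in> carrier R" "y \<in> S" "x \<ominus> y \<in> S" shows "x \<in> S"
proof -
  have "x = (x \<ominus> y) \<oplus> y" using assms S_carrier[of y] by (simp add: ring_simprules)
  then show ?thesis using assms S_add by metis
qed

lemma minus_S_iff:
  assumes "x \<in> carrier R" "y \<in> carrier R" "x \<ominus> y \<in> S" shows "x \<in> S \<longleftrightarrow> y \<in> S"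
proof
  assume "x \<in> S"
  moreover have "y = x \<ominus> (x \<ominus> y)" using assms(1,2) by (simp add: ring_simprules add_cancel_middle)
  ultimately show "y \<in> S" using assms S_minus by metis
qed (use assms minus_S_cancel in blast)

text \<open>The element y = f x h has square zero because h f = 0, so 1 - y is a unit and lies in
  \<open>S\<close>.\<close>

lemma off_diagonal:
  assumes f: "f \<in> carrier R" and h: "h \<in> carrier R" and x: "x \<in> carrier R" and hf: "h \<otimes> f = \<zero>"
  shows "f \<otimes> x \<otimes> h \<in> S"
proof -
  let ?y = "f \<otimes> x \<otimes> h"
  have "?y \<otimes> ?y = f \<otimes> x \<otimes> (h \<otimes> f) \<otimes> x \<otimes> h" using f h x by (simp add: m_assoc)
  then have "?y \<otimes> ?y = \<zero>" using f h x by (simp add: hf)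
  then have "\<one> \<ominus> ?y \<in> S" using square_zero_Units[of ?y] Units_subset f h x by auto
  moreover have "?y = \<one> \<ominus> (\<one> \<ominus> ?y)" using f h x by (simp add: ring_simprules)
  ultimately show ?thesis using S_minus[OF S_one] by metis
qed

text \<open>Inserting 1 = f + (1 - f) between \<open>x\<close> and \<open>y\<close> shows the
  difference to be the product of f x (1 - f) and (1 - f) y f, both in \<open>S\<close> by
  \<open>off_diagonal\<close>. So compression to the corner is multiplicative modulo
  \<open>S\<close>.\<close>

lemma corner_mult_mod:
  assumes f: "f \<in> carrier R" and ff: "f \<otimes> f = f" and x: "x \<in> carrier R" and y: "y \<in> carrier R"
  shows "f \<otimes> (x \<otimes> y) \<otimes> f \<ominus> (f \<otimes> x \<otimes> f) \<otimes> (f \<otimes> y \<otimes> f) \<in> S"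
proof -
  let ?g = "\<one> \<ominus> f"
  have g: "?g \<in> carrier R" using f by simp
  have gf: "?g \<otimes> f = \<zero>" "f \<otimes> ?g = \<zero>" "?g \<otimes> ?g = ?g"
    using f by (simp_all add: ring_simprules ff)
  have "(f \<otimes> x \<otimes> f) \<otimes> (f \<otimes> y \<otimes> f) = f \<otimes> x \<otimes> (f \<otimes> f) \<otimes> y \<otimes> f"
    using f x y by (simp add: m_assoc)
  then have 1: "(f \<otimes> x \<otimes> f) \<otimes> (f \<otimes> y \<otimes> f) = f \<otimes> x \<otimes> f \<otimes> y \<otimes> f"
    by (simp add: ff)
  have "(f \<otimes> x \<otimes> ?g) \<otimes> (?g \<otimes> y \<otimes> f) = f \<otimes> x \<otimes> (?g \<otimes> ?g) \<otimes> y \<otimes> f"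
    using f x y g by (simp add: m_assoc)
  also have "\<dots> = f \<otimes> x \<otimes> ?g \<otimes> y \<otimes> f"
    by (simp only: gf)
  also have "\<dots> = f \<otimes> (x \<otimes> y) \<otimes> f \<ominus> f \<otimes> x \<otimes> f \<otimes> y \<otimes> f"
    using f x y by (simp add: ring_simprules)
  finally show ?thesis
    using 1 S_mult[OF off_diagonal[OF f g x gf(1)] off_diagonal[OF g f y gf(2)]] by simp
qed

text \<open>The equations e f = e = f e are the usual order on idempotents. Zero needs no exception,
  since it lies in \<open>S\<close>.\<close>

definition minimal_idempotent :: "'a \<Rightarrow> bool" where
  "minimal_idempotent f \<longleftrightarrow> f \<in> carrier R \<and> f \<otimes> f = f \<and> f \<notin> S \<and>
     (\<forall>e\<in>carrier R. e \<otimes> e = e \<and> e \<otimes> f = e \<and> f \<otimes> e = e \<and> e \<notin> S \<longrightarrow> e = f)"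

text \<open>Among the idempotents outside \<open>S\<close> below \<open>g\<close>, one whose right
  ideal has least cardinality is minimal, since a strictly smaller idempotent generates a strictly
  smaller right ideal.\<close>

lemma minimal_idempotent_exists:
  assumes fin: "finite (carrier R)"
    and g: "g \<in> carrier R" "g \<otimes> g = g" "g \<notin> S"
  obtains h where "minimal_idempotent h" "h \<otimes> g = h" "g \<otimes> h = h"
proof -
  define E where "E = {h\<in>carrier R. h \<otimes> h = h \<and> h \<notin> S \<and> h \<otimes> g = h \<and> g \<otimes> h = h}"
  \<comment> \<open>For idempotent \<open>h\<close> this is the right ideal h R.\<close>
  define I where "I h = {x\<in>carrier R. h \<otimes> x = x}" for h
  have "g \<in> E" using g unfolding E_def by simp
  then obtain h where h: "h \<in> E" and least: "\<And>e. e \<in> E \<Longrightarrow> card (I h) \<le> card (I e)"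
    using ex_has_least_nat[of "\<lambda>e. e \<in> E" g "\<lambda>e. card (I e)"] by blast
  have "e = h" if e: "e \<in> carrier R" "e \<otimes> e = e" "e \<otimes> h = e" "h \<otimes> e = e" "e \<notin> S" for e
  proof (rule ccontr)
    assume "e \<noteq> h"
    have hc: "h \<in> carrier R" "h \<otimes> g = h" "g \<otimes> h = h" "h \<otimes> h = h" using h by (simp_all add: E_def)
    have "e \<otimes> g = e" using e(1,3) hc g(1) by (metis m_assoc)
    moreover have "g \<otimes> e = e" using e(1,4) hc g(1) by (metis m_assoc)
    ultimately have "e \<in> E" using e by (simp add: E_def)
    moreover have "I e \<subset> I h"
    proof
      show "I e \<subseteq> I h"
      proof
        fix x assume "x \<in> I e"
        then have x: "x \<in> carrier R" "e \<otimes> x = x" by (simp_all add: I_def)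
        have "h \<otimes> x = (h \<otimes> e) \<otimes> x" using x e(1) hc(1) by (simp add: m_assoc)
        then show "x \<in> I h" using x e(4) by (simp add: I_def)
      qed
      have "h \<in> I h" "h \<notin> I e" using \<open>e \<noteq> h\<close> hc e(3) unfolding I_def by simp_all
      then show "I e \<noteq> I h" by blast
    qed
    then have "card (I e) < card (I h)"
      by (intro psubset_card_mono) (use fin in \<open>simp_all add: I_def\<close>)
    ultimately show False using least by fastforce
  qed
  then have "minimal_idempotent h" using h unfolding minimal_idempotent_def E_def by auto
  then show thesis using that h by (simp add: E_def)
qed

text \<open>The idempotent congruent to a = f x f is both a right and a left multiple of
  \<open>a\<close>, hence lies below \<open>f\<close>; by minimality it is in \<open>S\<close> or
  equals \<open>f\<close>.\<close>

lemma corner_dichotomy: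
  assumes f: "minimal_idempotent f" and x: "x \<in> carrier R"
  shows "f \<otimes> x \<otimes> f \<in> S \<or> f \<otimes> x \<otimes> f \<ominus> f \<in> S"
proof -
  let ?a = "f \<otimes> x \<otimes> f"
  have fc: "f \<in> carrier R" "f \<otimes> f = f" using f unfolding minimal_idempotent_def by simp_all
  then have a: "?a \<in> carrier R" using x by simp
  from idempotent_mod[OF a] obtain e c d where e: "e \<in> carrier R" "e \<otimes> e = e" "?a \<ominus> e \<in> S"
    and c: "c \<in> carrier R" "e = ?a \<otimes> c" and d: "d \<in> carrier R" "e = d \<otimes> ?a" by blast
  have "f \<otimes> e = (f \<otimes> f) \<otimes> x \<otimes> f \<otimes> c" using c fc(1) x by (simp add: m_assoc)
  then have fe: "f \<otimes> e = e" using c fc(2) by simp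
  have "e \<otimes> f = d \<otimes> (f \<otimes> x \<otimes> (f \<otimes> f))" using d fc(1) x by (simp add: m_assoc)
  then have ef: "e \<otimes> f = e" using d fc(2) by simp
  have "e \<in> S \<or> e = f" using f e fe ef unfolding minimal_idempotent_def by blast
  then show ?thesis using e(3) minus_S_cancel[OF a] by blast
qed

text \<open>For minimal \<open>f\<close> the corner f R f has just two classes modulo
  \<open>S\<close>, those of 0 and \<open>f\<close>. This is the class of f x f, read as 0 or 1 of
  \<open>F\<close> without forming a quotient.\<close>

definition corner_char :: "('c, 'd) ring_scheme \<Rightarrow> 'a \<Rightarrow> 'a \<Rightarrow> 'c" where
  "corner_char F f x = (if f \<otimes> x \<otimes> f \<in> S then \<zero>\<^bsub>F\<^esub> else \<one>\<^bsub>F\<^esub>)"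

text \<open>As \<open>S\<close> is a subring and not an ideal, the mixed cases use that
  \<open>f\<close> acts as an identity: a f = a gives a b - a = a (b - f), a product of two elements
  of \<open>S\<close> when \<open>a\<close> and b - f are in \<open>S\<close>.\<close>

lemma mod_mult:
  assumes f: "f \<in> carrier R" "f \<otimes> f = f" "f \<notin> S"
    and a: "a \<in> carrier R" "a \<otimes> f = a" "a \<in> S \<or> a \<ominus> f \<in> S"
    and b: "b \<in> carrier R" "f \<otimes> b = b" "b \<in> S \<or> b \<ominus> f \<in> S"
  shows "a \<otimes> b \<in> S \<longleftrightarrow> a \<in> S \<or> b \<in> S"
proof -
  consider "a \<in> S" "b \<in> S" | "a \<in> S" "b \<ominus> f \<in> S" | "a \<ominus> f \<in> S" "b \<in> S"
    | "a \<ominus> f \<in> S" "b \<ominus> f \<in> S" using a(3) b(3) by blast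
  then show ?thesis
  proof cases
    case 1
    then show ?thesis using S_mult by blast
  next
    case 2
    have "a \<otimes> b \<ominus> a = a \<otimes> (b \<ominus> f)" using a b(1) f(1) by (simp add: minus_eq r_distr r_minus)
    then have "a \<otimes> b \<ominus> a \<in> S" using S_mult[OF 2] by simp
    then show ?thesis using minus_S_cancel[of "a \<otimes> b" a] 2(1) a(1) b(1) by simp
  next
    case 3
    have "a \<otimes> b \<ominus> b = (a \<ominus> f) \<otimes> b" using b a(1) f(1) by (simp add: minus_eq l_distr l_minus)
    then have "a \<otimes> b \<ominus> b \<in> S" using S_mult[OF 3] by simp
    then show ?thesis using minus_S_cancel[of "a \<otimes> b" b] 3(2) a(1) b(1) by simp
  next
    case 4
    \<comment> \<open>With s, t in \<open>S\<close> the product (s + f) (t + f) is s t + s + t + f,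
      hence congruent to \<open>f\<close>, which is outside \<open>S\<close>.\<close>
    define s t where "s = a \<ominus> f" and "t = b \<ominus> f"
    have st: "s \<in> carrier R" "t \<in> carrier R" "s \<otimes> f = s" "f \<otimes> t = t"
      using a b f by (simp_all add: s_def t_def minus_eq l_distr r_distr l_minus r_minus)
    have ab: "a = s \<oplus> f" "b = t \<oplus> f"
      using a(1) b(1) f(1) by (simp_all add: s_def t_def minus_eq a_assoc l_neg)
    have "a \<otimes> b = (s \<otimes> t \<oplus> s \<oplus> t) \<oplus> f"
      using st f by (simp add: ab l_distr r_distr a_assoc a_lcomm)
    then have "a \<otimes> b \<ominus> f = s \<otimes> t \<oplus> s \<oplus> t"
      using st(1,2) f(1) by (simp add: minus_eq a_assoc r_neg)
    moreover have "s \<otimes> t \<oplus> s \<oplus> t \<in> S"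
      using 4 unfolding s_def[symmetric] t_def[symmetric] by (intro S_add S_mult)
    ultimately have "a \<otimes> b \<ominus> f \<in> S" by simp
    then show ?thesis
      using 4 f minus_S_iff[of "a \<otimes> b" f] minus_S_iff[of a f] minus_S_iff[of b f] a(1) b(1) by simp
  qed
qed

text \<open>The classes of 0 and \<open>f\<close> add as in the field of two elements. If both
  summands are congruent to \<open>f\<close>, then f + f = 0 rewrites the sum as (a - f) + (b - f),
  which is in \<open>S\<close>.\<close>

lemma mod_add:
  assumes f: "f \<in> carrier R" "f \<oplus> f = \<zero>" "f \<notin> S"
    and a: "a \<in> carrier R" "a \<in> S \<or> a \<ominus> f \<in> S"
    and b: "b \<in> carrier R" "b \<in> S \<or> b \<ominus> f \<in> S"
  shows "a \<oplus> b \<in> S \<longleftrightarrow> (a \<in> S \<longleftrightarrow> b \<in> S)"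
proof -
  have diff: "(x \<oplus> y) \<ominus> y = x" if "x \<in> carrier R" "y \<in> carrier R" for x y
    using that by (simp add: minus_eq a_assoc r_neg)
  have absorb: "x \<oplus> y \<in> S \<longleftrightarrow> y \<in> S" if "x \<in> S" "y \<in> carrier R" for x y
    using minus_S_iff[of "x \<oplus> y" y] diff[of x y] that S_carrier by simp
  consider "a \<in> S" | "b \<in> S" | "a \<notin> S" "b \<notin> S" "a \<ominus> f \<in> S" "b \<ominus> f \<in> S" using a(2) b(2) by blast
  then show ?thesis
  proof cases
    case 1
    then show ?thesis using absorb b(1) by simp
  next
    case 2
    then show ?thesis using absorb[of b a] a(1) a_comm[OF a(1) b(1)] by simp
  next
    case 3
    have nf: "\<ominus> f = f" using f(1,2) by (metis minus_equality)
    have "a \<oplus> b = (a \<ominus> f) \<oplus> (b \<ominus> f)"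
    proof -
      have "(a \<ominus> f) \<oplus> (b \<ominus> f) = a \<oplus> (b \<oplus> (f \<oplus> f))"
        using a(1) b(1) f(1) by (simp only: minus_eq nf a_assoc a_comm a_lcomm a_closed)
      then show ?thesis using a(1) b(1) f(2) by simp
    qed
    then show ?thesis using 3 S_add by simp
  qed
qed

lemma corner_char_hom:
  assumes f: "minimal_idempotent f" and char2: "\<one> \<oplus> \<one> = \<zero>"
    and F: "ring F" and F2: "\<one>\<^bsub>F\<^esub> \<oplus>\<^bsub>F\<^esub> \<one>\<^bsub>F\<^esub> = \<zero>\<^bsub>F\<^esub>"
  shows "corner_char F f \<in> ring_hom R F"
proof -
  interpret F: ring F by fact
  have fc: "f \<in> carrier R" "f \<otimes> f = f" and fS: "f \<notin> S"
    using f unfolding minimal_idempotent_def by simp_all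
  have two: "f \<oplus> f = \<zero>"
    using char2 l_distr[OF one_closed one_closed fc(1)] fc(1) by simp
  have cc: "f \<otimes> x \<otimes> f \<in> carrier R" and cf: "f \<otimes> x \<otimes> f \<otimes> f = f \<otimes> x \<otimes> f"
    and fcx: "f \<otimes> (f \<otimes> x \<otimes> f) = f \<otimes> x \<otimes> f" if "x \<in> carrier R" for x
    using that fc by (simp_all add: m_assoc[symmetric]) (simp add: m_assoc)
  show ?thesis
  proof (rule ring_hom_memI)
    fix x y assume x: "x \<in> carrier R" and y: "y \<in> carrier R"
    have "f \<otimes> (x \<otimes> y) \<otimes> f \<in> S \<longleftrightarrow> (f \<otimes> x \<otimes> f) \<otimes> (f \<otimes> y \<otimes> f) \<in> S"
      using x y fc by (intro minus_S_iff corner_mult_mod) simp_all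
    also have "\<dots> \<longleftrightarrow> f \<otimes> x \<otimes> f \<in> S \<or> f \<otimes> y \<otimes> f \<in> S"
      by (rule mod_mult[OF fc fS cc[OF x] cf[OF x] corner_dichotomy[OF f x]
            cc[OF y] fcx[OF y] corner_dichotomy[OF f y]])
    finally show "corner_char F f (x \<otimes> y) = corner_char F f x \<otimes>\<^bsub>F\<^esub> corner_char F f y"
      by (simp add: corner_char_def)
    have "f \<otimes> (x \<oplus> y) \<otimes> f = (f \<otimes> x \<otimes> f) \<oplus> (f \<otimes> y \<otimes> f)"
      using x y fc(1) by (simp add: r_distr l_distr)
    then have "f \<otimes> (x \<oplus> y) \<otimes> f \<in> S \<longleftrightarrow> (f \<otimes> x \<otimes> f \<in> S \<longleftrightarrow> f \<otimes> y \<otimes> f \<in> S)"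
      using mod_add[OF fc(1) two fS cc[OF x] corner_dichotomy[OF f x] cc[OF y] corner_dichotomy[OF f y]]
      by simp
    then show "corner_char F f (x \<oplus> y) = corner_char F f x \<oplus>\<^bsub>F\<^esub> corner_char F f y"
      by (simp add: corner_char_def F2)
  qed (use fc fS in \<open>simp_all add: corner_char_def\<close>)
qed

end

section \<open>Finite dimension: descending chains, finiteness, Fitting's lemma\<close>

text \<open>At an index \<open>k\<close> of least dimension, a largest independent set
  \<open>X\<close> in W (k + 1) cannot be enlarged inside W k, so its span contains W k.\<close>

lemma (in vectorspace) descending_chain_stabilises:
  assumes fd: "fin_dim" and sub: "\<And>k :: nat. submodule K (W k) V"
    and desc: "\<And>k. W (Suc k) \<subseteq> W k"
  shows "\<exists>k. W (Suc k) = W k"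
proof -
  define P where "P k X \<longleftrightarrow> X \<subseteq> W k \<and> lin_indpt X" for k X
  \<comment> \<open>This is the dimension of \<open>W k\<close>, expressed by independent subsets of
    \<open>V\<close> so that \<open>W k\<close> need not be made a vector space of its own.\<close>
  define r where "r k = Max (card ` Collect (P k))" for k
  have WV: "W k \<subseteq> carrier V" for k using sub[of k] by (rule submodule.subset)
  have fin: "finite X" and le: "card X \<le> dim" if "P k X" for k X
    using li_le_dim[OF fd] that WV[of k] unfolding P_def by blast+
  have finP: "finite (card ` Collect (P k))" for k
    by (rule finite_subset[of _ "{..dim}"]) (auto dest: le)
  have P_empty: "P k {}" for k unfolding P_def lin_dep_def by auto
  obtain k where least: "\<And>j. r k \<le> r j"
    using ex_has_least_nat[of "\<lambda>_. True" _ r] by auto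
  have "r (Suc k) \<in> card ` Collect (P (Suc k))"
    unfolding r_def using finP P_empty by (intro Max_in) auto
  then obtain X where X: "P (Suc k) X" "card X = r (Suc k)" by auto
  have XW: "X \<subseteq> W (Suc k)" "lin_indpt X" "X \<subseteq> carrier V"
    using X(1) WV unfolding P_def by blast+
  have "W k \<subseteq> span X"
  proof
    fix v assume v: "v \<in> W k"
    show "v \<in> span X"
    proof (rule ccontr)
      assume nv: "v \<notin> span X"
      then have vX: "v \<notin> X" using in_own_span[OF XW(3)] by blast
      have "P k (X \<union> {v})"
        using lin_dep_iff_in_span[OF XW(3,2) _ vX] nv v WV[of k] XW(1) desc[of k] unfolding P_def by auto
      then have "card (X \<union> {v}) \<le> r k" unfolding r_def using finP by (intro Max_ge) auto
      then show False using vX fin[OF X(1)] X(2) least[of "Suc k"] by simp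
    qed
  qed
  also have "span X \<subseteq> W (Suc k)" using span_is_subset[OF XW(1) sub] .
  finally show ?thesis using desc[of k] by blast
qed

lemma (in vectorspace) finite_carrier:
  assumes fd: "fin_dim" and K: "finite (carrier K)"
  shows "finite (carrier V)"
proof -
  obtain B where B: "finite B" "B \<subseteq> carrier V" "span B = carrier V"
    using fd unfolding fin_dim_def by blast
  \<comment> \<open>Coefficient functions are cut down to extensional ones on \<open>B\<close>, of
    which there are finitely many.\<close>
  have "carrier V \<subseteq> (\<lambda>a. lincomb a B) ` (B \<rightarrow>\<^sub>E carrier K)"
  proof
    fix v assume "v \<in> carrier V"
    then obtain a where a: "a \<in> B \<rightarrow> carrier K" "lincomb a B = v"
      using finite_in_span[OF B(1,2)] B(3) by auto
    then have "lincomb (restrict a B) B = v" "restrict a B \<in> B \<rightarrow>\<^sub>E carrier K"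
      using lincomb_cong[of B B "restrict a B" a] B(2) by auto
    then show "v \<in> (\<lambda>a. lincomb a B) ` (B \<rightarrow>\<^sub>E carrier K)" by blast
  qed
  then show ?thesis by (rule finite_subset) (use B(1) K in \<open>intro finite_imageI finite_PiE\<close>)
qed

text \<open>The descending chain is \<open>a\<^sup>k C\<close> with \<open>C\<close> the centraliser of \<open>a\<close>, which forces the witness of
  stabilisation to commute with \<open>a\<close>.\<close>

lemma unital_algebra_fitting:
  fixes A (structure)
  assumes alg: "unital_algebra F A" and fd: "vectorspace.fin_dim F A" and a: "a \<in> carrier A"
  obtains e c u v where "e \<in> carrier A" "e \<otimes> e = e" "c \<in> carrier A" "e = a \<otimes> c" "e = c \<otimes> a"
    "u \<in> Units A" "v \<in> Units A" "a \<ominus> e = u \<ominus> v"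
proof -
  interpret A: ring A using alg by (rule unital_algebra.axioms)
  interpret V: vectorspace F A using alg by (rule unital_algebra.axioms)
  define C where "C = {x \<in> carrier A. a \<otimes> x = x \<otimes> a}"
  define W where "W k = (\<lambda>x. a [^] k \<otimes> x) ` C" for k :: nat
  have pow: "a [^] k \<in> carrier A" for k :: nat using a by simp
  have "submodule F (W k) A" for k
  proof (rule submodule.intro)
    show "Module.module F A" by (rule V.module_axioms)
    show "W k \<subseteq> carrier A" using pow by (auto simp: W_def C_def)
    show "\<zero> \<in> W k" unfolding W_def using a pow by (intro image_eqI[of _ _ \<zero>]) (simp_all add: C_def)
  next
    fix v w assume "v \<in> W k" "w \<in> W k"
    then obtain x y where "x \<in> C" "y \<in> C" "v = a [^] k \<otimes> x" "w = a [^] k \<otimes> y"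
      unfolding W_def by blast
    then show "v \<oplus> w \<in> W k" unfolding W_def using a pow
      by (intro image_eqI[of _ _ "x \<oplus> y"]) (simp_all add: C_def A.r_distr A.l_distr)
  next
    fix c v assume c: "c \<in> carrier F" and "v \<in> W k"
    then obtain x where "x \<in> C" "v = a [^] k \<otimes> x" unfolding W_def by blast
    then show "c \<odot> v \<in> W k" unfolding W_def using a pow c
        unital_algebra.smult_mult_left[OF alg c] unital_algebra.smult_mult_right[OF alg c]
      by (intro image_eqI[of _ _ "c \<odot> x"]) (simp_all add: C_def)
  qed
  moreover have "W (Suc k) \<subseteq> W k" for k
  proof
    fix v assume "v \<in> W (Suc k)"
    then obtain x where x: "x \<in> C" "v = a [^] Suc k \<otimes> x" unfolding W_def by blast
    have "a \<otimes> x \<in> C" using x(1) a unfolding C_def by (auto simp: A.m_assoc[symmetric])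
    moreover have "v = a [^] k \<otimes> (a \<otimes> x)" using x a pow by (simp add: C_def A.m_assoc)
    ultimately show "v \<in> W k" unfolding W_def by blast
  qed
  ultimately obtain k where k: "W (Suc k) = W k"
    using V.descending_chain_stabilises[OF fd] by blast
  \<comment> \<open>Stability is applied to a^k 1: its membership in W (k + 1) is exactly a^k =
    a^(k+1) b with \<open>b\<close> commuting with \<open>a\<close>.\<close>
  have "a [^] k \<in> W k" unfolding W_def using a pow by (intro image_eqI[of _ _ \<one>]) (simp_all add: C_def)
  then have "a [^] k \<in> W (Suc k)" by (simp only: k)
  then obtain b where b: "b \<in> carrier A" "a \<otimes> b = b \<otimes> a" "a [^] k = a [^] Suc k \<otimes> b"
    unfolding W_def C_def by blast
  show thesis by (rule A.fitting_idempotent[OF a b]) (rule that)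
qed

section \<open>The span of the units of an algebra\<close>

text \<open>Products of units are units, and this extends linearly one factor at a time: first to
  the right factor with a unit on the left, then to the left factor. Each time the admissible
  factors form a submodule containing the units.\<close>

lemma span_Units_subring:
  assumes alg: "unital_algebra F A"
  shows "subring (LinearCombinations.module.span F A (Units A)) A"
proof -
  interpret A: ring A using alg by (rule unital_algebra.axioms)
  interpret V: vectorspace F A using alg by (rule unital_algebra.axioms)
  note smult = unital_algebra.smult_mult_left[OF alg] unital_algebra.smult_mult_right[OF alg]
  let ?S = "V.span (Units A)"
  have U: "Units A \<subseteq> carrier A" using A.Units_closed by blast
  have sm: "submodule F ?S A" using V.span_is_submodule[OF U] .
  have US: "Units A \<subseteq> ?S" using V.in_own_span[OF U] .
  have Sc: "?S \<subseteq> carrier A" using V.span_is_subset2[OF U] .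
  have unit_mult: "u \<otimes>\<^bsub>A\<^esub> x \<in> ?S" if u: "u \<in> Units A" and x: "x \<in> ?S" for u x
  proof -
    let ?N = "{x \<in> carrier A. u \<otimes>\<^bsub>A\<^esub> x \<in> ?S}"
    have uc: "u \<in> carrier A" using u U by blast
    have "submodule F ?N A"
      using submodule.m_closed[OF sm] submodule.zero_closed[OF sm] submodule.smult_closed[OF sm] uc V.module_axioms
      by unfold_locales (auto simp: A.r_distr smult)
    moreover have "Units A \<subseteq> ?N" using u U US by auto
    ultimately show ?thesis using V.span_is_subset x by blast
  qed
  have mult: "y \<otimes>\<^bsub>A\<^esub> x \<in> ?S" if y: "y \<in> ?S" and x: "x \<in> ?S" for x y
  proof -
    let ?N = "{y \<in> carrier A. y \<otimes>\<^bsub>A\<^esub> x \<in> ?S}"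
    have xc: "x \<in> carrier A" using x Sc by blast
    have "submodule F ?N A"
      using submodule.m_closed[OF sm] submodule.zero_closed[OF sm] submodule.smult_closed[OF sm] xc V.module_axioms
      by unfold_locales (auto simp: A.l_distr smult)
    moreover have "Units A \<subseteq> ?N" using x U unit_mult by auto
    ultimately show ?thesis using V.span_is_subset y by blast
  qed
  show ?thesis
  proof (rule A.subringI)
    show "\<ominus>\<^bsub>A\<^esub> h \<in> ?S" if h: "h \<in> ?S" for h
      using submodule.smult_closed[OF sm _ h, of "\<ominus>\<^bsub>F\<^esub> \<one>\<^bsub>F\<^esub>"] V.smult_minus_1[of h] h Sc by auto
  qed (use Sc US mult submodule.m_closed[OF sm] in auto)
qed

text \<open>Fitting's lemma writes a - e as a difference of two units, which lies in their
  span.\<close>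

lemma span_Units_units_subring:
  assumes alg: "unital_algebra F A" and fd: "vectorspace.fin_dim F A"
  shows "units_subring A (LinearCombinations.module.span F A (Units A))"
proof -
  interpret A: ring A using alg by (rule unital_algebra.axioms)
  interpret V: vectorspace F A using alg by (rule unital_algebra.axioms)
  let ?S = "V.span (Units A)"
  have U: "Units A \<subseteq> carrier A" using A.Units_closed by blast
  have S: "subring ?S A" using span_Units_subring[OF alg] .
  have US: "Units A \<subseteq> ?S" using V.in_own_span[OF U] .
  show ?thesis
  proof (intro units_subring.intro units_subring_axioms.intro)
    fix a assume "a \<in> carrier A"
    from unital_algebra_fitting[OF alg fd this] obtain e c u v where
      e: "e \<in> carrier A" "e \<otimes>\<^bsub>A\<^esub> e = e" "c \<in> carrier A" "e = a \<otimes>\<^bsub>A\<^esub> c" "e = c \<otimes>\<^bsub>A\<^esub> a"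
      and uv: "u \<in> Units A" "v \<in> Units A" "a \<ominus>\<^bsub>A\<^esub> e = u \<ominus>\<^bsub>A\<^esub> v" .
    have "u \<ominus>\<^bsub>A\<^esub> v \<in> ?S"
      unfolding A.minus_eq using uv US by (intro subringE(5,7)[OF S]) auto
    then have "a \<ominus>\<^bsub>A\<^esub> e \<in> ?S" using uv(3) by simp
    then show "\<exists>e\<in>carrier A. e \<otimes>\<^bsub>A\<^esub> e = e \<and> (\<exists>c\<in>carrier A. e = a \<otimes>\<^bsub>A\<^esub> c) \<and>
        (\<exists>c\<in>carrier A. e = c \<otimes>\<^bsub>A\<^esub> a) \<and> a \<ominus>\<^bsub>A\<^esub> e \<in> ?S"
      using e by blast
  qed (use S US A.ring_axioms in auto)
qed

text \<open>Since c is nonzero, 1 - e + c e is a unit with inverse 1 - e + c^(-1) e. Subtracting the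
  unit 1 leaves (c - 1) e in the span, and c - 1 can be divided out because c differs from
  1.\<close>

lemma idempotent_in_span_Units:
  fixes A (structure)
  assumes alg: "unital_algebra F A" and e: "e \<in> carrier A" "e \<otimes> e = e"
    and c: "c \<in> carrier F" "c \<noteq> \<zero>\<^bsub>F\<^esub>" "c \<noteq> \<one>\<^bsub>F\<^esub>"
  shows "e \<in> LinearCombinations.module.span F A (Units A)"
proof -
  interpret F: field F using alg by (intro vectorspace.axioms(2) unital_algebra.axioms(1))
  interpret A: ring A using alg by (rule unital_algebra.axioms)
  interpret V: vectorspace F A using alg by (rule unital_algebra.axioms)
  note smult = unital_algebra.smult_mult_left[OF alg] unital_algebra.smult_mult_right[OF alg]
  let ?S = "V.span (Units A)"
  have U: "Units A \<subseteq> carrier A" using A.Units_closed by blast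
  have sm: "submodule F ?S A" using V.span_is_submodule[OF U] .
  have US: "Units A \<subseteq> ?S" using V.in_own_span[OF U] .
  have prod: "(\<one> \<ominus> e \<oplus> b \<odot> e) \<otimes> (\<one> \<ominus> e \<oplus> d \<odot> e) = \<one>"
    if b: "b \<in> carrier F" and d: "d \<in> carrier F" and bd: "b \<otimes>\<^bsub>F\<^esub> d = \<one>\<^bsub>F\<^esub>" for b d
  proof -
    have g: "(\<one> \<ominus> e) \<otimes> (\<one> \<ominus> e) = \<one> \<ominus> e" "(\<one> \<ominus> e) \<otimes> e = \<zero>" "e \<otimes> (\<one> \<ominus> e) = \<zero>"
      using e by (simp_all add: A.ring_simprules)
    have "b \<odot> e \<otimes> (d \<odot> e) = b \<odot> (d \<odot> e)"
      using smult(1)[OF b e(1), of "d \<odot> e"] smult(2)[OF d e(1) e(1)] d e by simp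
    also have "\<dots> = e" using b d e bd V.smult_assoc1[of b d e] by simp
    finally have be: "b \<odot> e \<otimes> (d \<odot> e) = e" .
    have "(\<one> \<ominus> e) \<otimes> (d \<odot> e) = \<zero>" "b \<odot> e \<otimes> (\<one> \<ominus> e) = \<zero>"
      using b d e g smult by simp_all
    then have "(\<one> \<ominus> e \<oplus> b \<odot> e) \<otimes> (\<one> \<ominus> e \<oplus> d \<odot> e) = (\<one> \<ominus> e) \<oplus> e"
      using b d e g(1) be by (simp add: A.l_distr A.r_distr)
    then show ?thesis using e by (simp add: A.minus_eq A.a_assoc A.l_neg)
  qed
  let ?w = "\<one> \<ominus> e \<oplus> c \<odot> e"
  have ci: "inv\<^bsub>F\<^esub> c \<in> carrier F" "c \<otimes>\<^bsub>F\<^esub> inv\<^bsub>F\<^esub> c = \<one>\<^bsub>F\<^esub>" "inv\<^bsub>F\<^esub> c \<otimes>\<^bsub>F\<^esub> c = \<one>\<^bsub>F\<^esub>"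
    using c F.field_Units by (auto simp: F.Units_r_inv F.Units_l_inv)
  have "?w \<in> Units A"
    unfolding Units_def using prod[OF c(1) ci(1,2)] prod[OF ci(1) c(1) ci(3)] c(1) ci(1) e(1) by auto
  then have w: "?w \<in> ?S" using US by blast
  define z where "z = c \<ominus>\<^bsub>F\<^esub> \<one>\<^bsub>F\<^esub>"
  have z: "z \<in> carrier F" "z \<noteq> \<zero>\<^bsub>F\<^esub>"
    using c by (simp_all add: z_def)
  have "z \<odot> e = \<ominus> e \<oplus> c \<odot> e"
    using c(1) e(1) by (simp add: z_def F.minus_eq V.smult_l_distr V.smult_l_minus A.a_comm)
  also have "\<dots> = ?w \<ominus> \<one>"
    using A.add_cancel_middle(1)[of \<one> "\<ominus> e \<oplus> c \<odot> e"] c(1) e(1) by (simp add: A.minus_eq A.a_assoc)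
  also have "\<dots> \<in> ?S"
    using w US subringE(5,7)[OF span_Units_subring[OF alg]] A.Units_one_closed by (auto simp: A.minus_eq)
  finally have ze: "z \<odot> e \<in> ?S" .
  have "inv\<^bsub>F\<^esub> z \<in> carrier F" using z F.field_Units by auto
  then have "inv\<^bsub>F\<^esub> z \<odot> (z \<odot> e) \<in> ?S" using submodule.smult_closed[OF sm _ ze] by blast
  then show ?thesis using V.mult_inverse[OF z(1) e(1) refl z(2)] by simp
qed

section \<open>The square of the two-element field as a factor algebra\<close>

text \<open>The first isomorphism theorem gives the ring isomorphism. It is linear because the only
  scalars are 0 and 1, which every ring homomorphism respects.\<close>

lemma has_F2_square_factorI:
  assumes alg: "unital_algebra F A" and card: "card (carrier F) = 2"
    and hom: "\<phi> \<in> ring_hom A (RDirProd F F)" and surj: "\<phi> ` carrier A = carrier F \<times> carrier F"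
  shows "has_F2_square_factor F A"
proof -
  interpret F: field F using alg by (intro vectorspace.axioms(2) unital_algebra.axioms(1))
  interpret A: ring A using alg by (rule unital_algebra.axioms)
  interpret V: vectorspace F A using alg by (rule unital_algebra.axioms)
  have F_carrier: "carrier F = {\<zero>\<^bsub>F\<^esub>, \<one>\<^bsub>F\<^esub>}"
    using card card_seteq[of "carrier F" "{\<zero>\<^bsub>F\<^esub>, \<one>\<^bsub>F\<^esub>}"] card.infinite[of "carrier F"] by auto
  interpret h: ring_hom_ring A "RDirProd F F" \<phi>
    using A.ring_axioms RDirProd_ring[OF F.ring_axioms F.ring_axioms] hom
    by (intro ring_hom_ringI2)
  let ?I = "a_kernel A (RDirProd F F) \<phi>"
  let ?h = "\<lambda>X. the_elem (\<phi> ` X)"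
  have I: "ideal ?I A" by (rule h.kernel_is_ideal)
  have iso: "?h \<in> ring_iso (A Quot ?I) (RDirProd F F)"
    using surj by (intro h.FactRing_iso_set) (simp add: RDirProd_carrier)
  have ops: "carrier (square_algebra F) = carrier (RDirProd F F)"
    "mult (square_algebra F) = mult (RDirProd F F)"
    "one (square_algebra F) = one (RDirProd F F)"
    "add (square_algebra F) = add (RDirProd F F)"
    by (simp_all add: square_algebra_def ring.defs)
  have iso': "?h \<in> ring_iso (factor_algebra A ?I) (square_algebra F)"
    using iso by (simp add: ring_iso_def ring_hom_def factor_algebra_simps ops)
  have "?h (c \<odot>\<^bsub>factor_algebra A ?I\<^esub> X) = c \<odot>\<^bsub>square_algebra F\<^esub> ?h X"
    if c: "c \<in> carrier F" and X: "X \<in> carrier (factor_algebra A ?I)" for c X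
  proof -
    obtain x where x: "x \<in> carrier A" "X = ?I +>\<^bsub>A\<^esub> x"
      using X by (auto simp: factor_algebra_simps FactRing_def A_RCOSETS_def')
    obtain p q where pq: "\<phi> x = (p, q)" "p \<in> carrier F" "q \<in> carrier F"
      using h.hom_closed[OF x(1)] by (auto simp: RDirProd_carrier)
    have "\<phi> (c \<odot>\<^bsub>A\<^esub> x) = c \<odot>\<^bsub>square_algebra F\<^esub> \<phi> x"
    proof (cases "c = \<zero>\<^bsub>F\<^esub>")
      case True
      then show ?thesis using pq x(1) h.hom_zero
        by (simp add: square_algebra_simps RDirProd_def DirProd_def monoid.defs)
    next
      case False
      then show ?thesis using c F_carrier pq x(1) by (simp add: square_algebra_simps)
    qed
    moreover have "c \<odot>\<^bsub>factor_algebra A ?I\<^esub> X = ?I +>\<^bsub>A\<^esub> (c \<odot>\<^bsub>A\<^esub> x)"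
      using unital_algebra.smult_coset[OF alg I c x(1)] x(2) by simp
    ultimately show ?thesis using x c by simp
  qed
  then have "?h \<in> LinearCombinations.module_hom F (factor_algebra A ?I) (square_algebra F)"
    using iso' unfolding LinearCombinations.module_hom_def ring_iso_def ring_hom_def by auto
  then show ?thesis
    using card I iso' unfolding has_F2_square_factor_def algebra_isomorphic_def by blast
qed

lemma has_F2_square_factor_if_missing_idempotent:
  fixes A (structure)
  assumes alg: "unital_algebra F A" and fd: "vectorspace.fin_dim F A"
    and F_carrier: "carrier F = {\<zero>\<^bsub>F\<^esub>, \<one>\<^bsub>F\<^esub>}"
    and e: "e \<in> carrier A" "e \<otimes> e = e" "e \<notin> LinearCombinations.module.span F A (Units A)"
  shows "has_F2_square_factor F A"
proof -
  interpret F: field F using alg by (intro vectorspace.axioms(2) unital_algebra.axioms(1))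
  interpret S: units_subring A "LinearCombinations.module.span F A (Units A)"
    using span_Units_units_subring[OF alg fd] .
  interpret V: vectorspace F A using alg by (rule unital_algebra.axioms)
  let ?S = "LinearCombinations.module.span F A (Units A)"
  have two: "\<one>\<^bsub>F\<^esub> \<oplus>\<^bsub>F\<^esub> \<one>\<^bsub>F\<^esub> = \<zero>\<^bsub>F\<^esub>"
  proof -
    have "\<one>\<^bsub>F\<^esub> \<oplus>\<^bsub>F\<^esub> \<one>\<^bsub>F\<^esub> \<in> {\<zero>\<^bsub>F\<^esub>, \<one>\<^bsub>F\<^esub>}" using F_carrier F.a_closed[OF F.one_closed F.one_closed] by simp
    \<comment> \<open>The other possibility, 1 + 1 = 1, would give 1 = 0.\<close>
    then show ?thesis using F.one_not_zero F.add.l_cancel_one'[of "\<one>\<^bsub>F\<^esub>" "\<one>\<^bsub>F\<^esub>"] by auto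
  qed
  then have two': "\<one> \<oplus> \<one> = \<zero>"
    using V.smult_l_distr[of "\<one>\<^bsub>F\<^esub>" "\<one>\<^bsub>F\<^esub>" \<one>] by simp
  have fin: "finite (carrier A)" using V.finite_carrier[OF fd] F_carrier by simp
  obtain f where f: "S.minimal_idempotent f" using S.minimal_idempotent_exists[OF fin e] by blast
  have fc: "f \<in> carrier A" "f \<otimes> f = f" "f \<notin> ?S" using f unfolding S.minimal_idempotent_def by simp_all
  have g: "\<one> \<ominus> f \<in> carrier A" "(\<one> \<ominus> f) \<otimes> (\<one> \<ominus> f) = \<one> \<ominus> f"
    using fc(1,2) by (simp_all add: S.ring_simprules)
  have "f = \<one> \<ominus> (\<one> \<ominus> f)" using fc(1) by (simp add: S.ring_simprules)
  then have gS: "\<one> \<ominus> f \<notin> ?S" using fc(3) S.S_minus[OF S.S_one] by metis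
  obtain h where h: "S.minimal_idempotent h" "h \<otimes> (\<one> \<ominus> f) = h"
    using S.minimal_idempotent_exists[OF fin g gS] by blast
  have hc: "h \<in> carrier A" "h \<otimes> h = h" "h \<notin> ?S" using h(1) unfolding S.minimal_idempotent_def by simp_all
  \<comment> \<open>This separates the two characters: the one of \<open>f\<close> vanishes at
    \<open>h\<close>, while the one of \<open>h\<close> is 1 there.\<close>
  have hf: "f \<otimes> h \<otimes> f = \<zero>"
  proof -
    have "h \<otimes> f = h \<otimes> ((\<one> \<ominus> f) \<otimes> f)" using h(2) hc(1) fc(1) g(1) by (metis S.m_assoc)
    also have "(\<one> \<ominus> f) \<otimes> f = \<zero>" using fc(1,2) by (simp add: S.ring_simprules)
    finally show ?thesis using hc(1) fc(1) by (simp add: S.m_assoc)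
  qed
  let ?\<chi> = "S.corner_char F"
  let ?\<phi> = "\<lambda>x. (?\<chi> f x, ?\<chi> h x)"
  have hom: "?\<chi> f \<in> ring_hom A F" "?\<chi> h \<in> ring_hom A F"
    using f h(1) two two' F.ring_axioms by (auto intro: S.corner_char_hom)
  have phi: "?\<phi> \<in> ring_hom A (RDirProd F F)"
    using hom unfolding ring_hom_def by (auto simp: RDirProd_def DirProd_def monoid.defs)
  have vals: "?\<phi> \<zero> = (\<zero>\<^bsub>F\<^esub>, \<zero>\<^bsub>F\<^esub>)" "?\<phi> \<one> = (\<one>\<^bsub>F\<^esub>, \<one>\<^bsub>F\<^esub>)" "?\<phi> h = (\<zero>\<^bsub>F\<^esub>, \<one>\<^bsub>F\<^esub>)"
    using fc hc hf by (simp_all add: S.corner_char_def S.S_zero)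
  \<comment> \<open>The last of the four pairs: (1, 1) + (0, 1) = (1, 0) as 1 + 1 = 0.\<close>
  have "?\<phi> (\<one> \<oplus> h) = (\<one>\<^bsub>F\<^esub>, \<zero>\<^bsub>F\<^esub>)"
    using ring_hom_add[OF hom(1) S.one_closed hc(1)] ring_hom_add[OF hom(2) S.one_closed hc(1)] vals two by simp
  then have "{(\<zero>\<^bsub>F\<^esub>, \<zero>\<^bsub>F\<^esub>), (\<one>\<^bsub>F\<^esub>, \<one>\<^bsub>F\<^esub>), (\<zero>\<^bsub>F\<^esub>, \<one>\<^bsub>F\<^esub>), (\<one>\<^bsub>F\<^esub>, \<zero>\<^bsub>F\<^esub>)} \<subseteq> ?\<phi> ` carrier A"
    using vals hc(1) by (metis (no_types, lifting) S.add.m_closed S.one_closed S.zero_closed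
        empty_subsetI image_eqI insert_subset)
  then have "carrier F \<times> carrier F \<subseteq> ?\<phi> ` carrier A" unfolding F_carrier by auto
  moreover have "?\<phi> ` carrier A \<subseteq> carrier F \<times> carrier F"
    using ring_hom_closed[OF hom(1)] ring_hom_closed[OF hom(2)] by auto
  ultimately have surj: "?\<phi> ` carrier A = carrier F \<times> carrier F" by (rule equalityI[rotated])
  have "card (carrier F) = 2" using F_carrier F.one_not_zero by simp
  then show ?thesis by (rule has_F2_square_factorI[OF alg _ phi surj])
qed

section \<open>Units and subspaces of codimension one\<close>

theorem theorem3:
  fixes F :: "('a, 'n) ring_scheme"
    and A :: "('a, 'b, 'm) module_scheme"
    and H :: "'b set"
  assumes "field F"
    and "unital_algebra F A"
    and "vectorspace.fin_dim F A"
    and "\<one>\<^bsub>A\<^esub> \<noteq> \<zero>\<^bsub>A\<^esub>"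
    and "subspace F H A"
    and "vectorspace.dim F A = vectorspace.dim F (A\<lparr>carrier := H\<rparr>) + 1"
    and "\<not> has_F2_square_factor F A"
  shows "\<not> Units A \<subseteq> H"
proof
  assume UH: "Units A \<subseteq> H"
  interpret F: field F by fact
  interpret S: units_subring A "LinearCombinations.module.span F A (Units A)"
    using span_Units_units_subring assms(2,3) .
  interpret V: vectorspace F A using assms(2) by (rule unital_algebra.axioms)
  let ?S = "V.span (Units A)"
  have sub: "submodule F H A" using assms(5) by (simp add: subspace_def)
  \<comment> \<open>Otherwise the dimension equation would read d = d + 1.\<close>
  have "H \<noteq> carrier A" using assms(6) by auto
  then obtain a where a: "a \<in> carrier A" "a \<notin> H" using submodule.subset[OF sub] by blast
  have "a \<notin> ?S" using V.span_is_subset[OF UH sub] a(2) by blast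
  \<comment> \<open>An idempotent congruent to \<open>a\<close> modulo the span lies outside it, as
    \<open>a\<close> does.\<close>
  then obtain e where e: "e \<in> carrier A" "e \<otimes>\<^bsub>A\<^esub> e = e" "e \<notin> ?S"
    using S.idempotent_mod[OF a(1)] S.minus_S_cancel[OF a(1)] by blast
  have "carrier F = {\<zero>\<^bsub>F\<^esub>, \<one>\<^bsub>F\<^esub>}"
    using idempotent_in_span_Units[OF assms(2) e(1,2)] e(3) by blast
  then have "has_F2_square_factor F A"
    using has_F2_square_factor_if_missing_idempotent[OF assms(2,3) _ e] by blast
  then show False using assms(7) by contradiction
qed

end
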